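(* Let $m\ge 2$ be an integer with binary expansion $m=a_0+a_12+\cdots+a_k2^k+2^{k+1}$ ($k\ge 0$, $a_\ell\in\{0,1\}$). Put $s=a_0+a_12+\cdots+a_k2^k$ and $t=2^{k+1}-s$. Then $R_{m,m}$ consists of four copies of $R_{s,s}$ placed at the corners and one copy of $R_{t,t}$ placed at the center, i.e. \[ R_{m,m}=R_{s,s}\ \cup\ \bigl(R_{s,s}+(m-s,0)\bigr)\ \cup\ \bigl(R_{s,s}+(0,m-s)\bigr)\ \cup\ \bigl(R_{s,s}+(m-s,m-s)\bigr)\ \cup\ \bigl(R_{t,t}+(s,s)\bigr), \] where $A+(p,q)$ denotes the translate of $A\subset\mathbb{R}^2$ by $(p,q)$ and $R_{0,0}=\emptyset$.
   Context: For a positive integer $m$, the chocolate game $C_{m,m}$ is a two-player impartial game on an $m\times m$ chocolate bar of unit cells, exactly one of which is poisoned (known to both players); cells are $(i,j)\in\mathbb{Z}^2$ with $1\le i,j\le m$. Players alternately break the current bar along a grid line into two rectangular pieces, eat one and pass the other (always keeping the poisoned cell); a player who receives the $1\times1$ bar loses. A cell $(i,j)$ is a P-position if with poison at $(i,j)$ the second player has a winning strategy; $P_{m,m}$ denotes the set of P-positions. It is known that $(i,j)\in P_{m,m}$ iff $(i-1)\oplus(j-1)\oplus(m-i)\oplus(m-j)=0$ ($\oplus$ = bitwise XOR). The pattern is $R_{m,m}=\{(i-x,j-y)\in\mathbb{R}^2: 0\le x,y\le1,\ (i,j)\in P_{m,m}\}$. *)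

theory Defs
  imports Complex_Main "HOL-Library.Product_Plus"
begin

type_synonym cell = "int \<times> int"
type_synonym bar = "cell set"

definition full_bar :: "nat \<Rightarrow> bar" where
  "full_bar m = {1..int m} \<times> {1..int m}"

definition breaks_into :: "bar \<Rightarrow> bar \<Rightarrow> bar \<Rightarrow> bool" where
  "breaks_into B B1 B2 \<longleftrightarrow> B1 \<noteq> {} \<and> B2 \<noteq> {} \<and>
     ((\<exists>c. B1 = {(x, y) \<in> B. x \<le> c} \<and> B2 = {(x, y) \<in> B. c < x}) \<or>
      (\<exists>c. B1 = {(x, y) \<in> B. y \<le> c} \<and> B2 = {(x, y) \<in> B. c < y}))"

definition move :: "cell \<Rightarrow> bar \<Rightarrow> bar \<Rightarrow> bool" where
  "move p B K \<longleftrightarrow> p \<in> K \<and> (\<exists>E. breaks_into B K E \<or> breaks_into B E K)"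

text \<open>A play records the bars received so far. The first player receives the bars at even
  indices (starting with the whole bar at index 0), the second player those at odd indices, so the
  last bar of a play is in the hands of the first player iff the length of the play is odd.\<close>

definition play :: "nat \<Rightarrow> cell \<Rightarrow> bar list \<Rightarrow> bool" where
  "play m p bs \<longleftrightarrow> bs \<noteq> [] \<and> hd bs = full_bar m \<and>
     (\<forall>l. Suc l < length bs \<longrightarrow> move p (bs ! l) (bs ! Suc l))"

text \<open>A strategy maps the history of the play to the bar passed on.\<close>

definition second_follows :: "(bar list \<Rightarrow> bar) \<Rightarrow> bar list \<Rightarrow> bool" where
  "second_follows \<sigma> bs \<longleftrightarrow>
     (\<forall>l. odd l \<and> Suc l < length bs \<longrightarrow> bs ! Suc l = \<sigma> (take (Suc l) bs))"

text \<open>A winning strategy of the second player prescribes a legal move whenever one is called for,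
  and only the first player ever receives the bar consisting of the poisoned cell alone. Every move
  shrinks the bar, so there are no infinite plays to consider.\<close>

definition second_winning_strategy :: "nat \<Rightarrow> cell \<Rightarrow> (bar list \<Rightarrow> bar) \<Rightarrow> bool" where
  "second_winning_strategy m p \<sigma> \<longleftrightarrow>
     (\<forall>bs. play m p bs \<and> second_follows \<sigma> bs \<longrightarrow>
        (even (length bs) \<and> last bs \<noteq> {p} \<longrightarrow> move p (last bs) (\<sigma> bs)) \<and>
        (last bs = {p} \<longrightarrow> odd (length bs)))"

definition P_positions :: "nat \<Rightarrow> cell set" where
  "P_positions m = {p \<in> full_bar m. \<exists>\<sigma>. second_winning_strategy m p \<sigma>}"

text \<open>For \<open>m = 0\<close> there are no cells, so the pattern is empty.\<close>

definition pattern :: "nat \<Rightarrow> (real \<times> real) set" where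
  "pattern m = {(real_of_int i - x, real_of_int j - y) | i j x y.
     0 \<le> x \<and> x \<le> 1 \<and> 0 \<le> y \<and> y \<le> 1 \<and> (i, j) \<in> P_positions m}"

definition translate :: "(real \<times> real) set \<Rightarrow> real \<times> real \<Rightarrow> (real \<times> real) set" where
  "translate A v = (\<lambda>u. u + v) ` A"

end

theory Submission
  imports Defs
begin

text \<open>A bar is determined by the distances from the poisoned cell to its four sides, and a move
  decreases exactly one of them, so the game is Nim with four heaps. Hence \<open>(i, j)\<close> is a
  P-position iff the XOR of \<open>i - 1\<close> and \<open>m - i\<close> equals that of \<open>j - 1\<close> and \<open>m - j\<close>. For
  \<open>m = s + 2 ^ n\<close> with \<open>s < 2 ^ n\<close>, this number is \<open>2 ^ n\<close> plus the one of the bar of size \<open>s\<close>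
  on the two outer intervals of length \<open>s\<close>, and less than \<open>2 ^ n\<close> on the central interval, where
  it is the one of the bar of size \<open>2 ^ n - s\<close>.\<close>

unbundle bit_operations_syntax

section \<open>XOR arithmetic and the Nim lemma\<close>

lemma xor_eq_0_iff:
  fixes x y :: nat
  shows "x XOR y = 0 \<longleftrightarrow> x = y"
  by (metis xor.assoc xor.right_neutral xor_self_eq xor.left_neutral)

lemma xor_less_power:
  fixes x y n :: nat
  assumes "x < 2 ^ n" "y < 2 ^ n"
  shows "x XOR y < 2 ^ n"
  using assms by (metis take_bit_nat_eq_self take_bit_nat_less_exp take_bit_xor)

lemma power_add_eq_xor:
  fixes y n :: nat
  assumes "y < 2 ^ n"
  shows "2 ^ n + y = 2 ^ n XOR y"
proof (rule disjunctive_add_eq_xor, rule bit_eqI)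
  fix i
  have "\<not> bit y n"
    using assms by (simp add: bit_iff_odd)
  then show "bit (2 ^ n AND y) i = bit 0 i"
    by (auto simp: bit_and_iff bit_exp_iff)
qed

lemma xor_power_add:
  fixes x y n :: nat
  assumes "x < 2 ^ n" "y < 2 ^ n"
  shows "x XOR (2 ^ n + y) = 2 ^ n + (x XOR y)" "(2 ^ n + x) XOR y = 2 ^ n + (x XOR y)"
  using assms by (simp_all add: power_add_eq_xor xor_less_power xor.assoc xor.left_commute)

text \<open>XOR with \<open>mask n\<close> is the complement in \<open>n\<close> bits. It shares no
  bit with \<open>x\<close>, and \<open>x\<close> has no bits outside the mask, so adding
  \<open>x\<close> to it produces no carry and yields \<open>mask n\<close>, that is
  \<open>2 ^ n - 1\<close>.\<close>

lemma power_minus_Suc_eq_xor: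
  fixes x n :: nat
  assumes "x < 2 ^ n"
  shows "2 ^ n - Suc x = mask n XOR x"
proof -
  have x: "take_bit n x = x"
    using assms by (simp add: take_bit_nat_eq_self)
  have "(mask n XOR x) AND x = 0"
  proof (rule bit_eqI)
    fix i
    show "bit ((mask n XOR x) AND x) i = bit 0 i"
      using arg_cong[OF x, of "\<lambda>y. bit y i"] by (auto simp: bit_simps)
  qed
  then have "(mask n XOR x) + x = mask n XOR x XOR x"
    by (simp add: disjunctive_add_eq_xor xor.assoc)
  then have "mask n = (mask n XOR x) + x"
    by (simp add: xor.assoc)
  then show ?thesis
    by (simp add: mask_eq_exp_minus_1)
qed

lemma xor_div_two: "(x XOR y) div 2 = (x div 2) XOR (y div 2 :: nat)"
  by (rule bit_eqI) (simp add: bit_simps flip: bit_Suc)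

lemma xor_less_if_div_two_less:
  fixes x y :: nat
  shows "(x XOR y) div 2 < x div 2 \<Longrightarrow> x XOR y < x"
  by linarith

lemma odd_xor_one_less:
  fixes x :: nat
  shows "odd x \<Longrightarrow> x XOR 1 < x"
  using xor_one_eq[of x] by (auto elim!: oddE)

text \<open>The Nim lemma: some heap contains the top bit of the Nim sum \<open>v\<close>, and XOR
  with \<open>v\<close> decreases it. Instead of naming the top bit, the induction halves all
  numbers until \<open>v = 1\<close>; then some heap is odd and loses its last bit. A decrease after
  halving is a decrease before.\<close>

lemma ex_xor_less:
  fixes a b c d :: nat
  assumes "a XOR b XOR c XOR d = v" "v \<noteq> 0"
  shows "a XOR v < a \<or> b XOR v < b \<or> c XOR v < c \<or> d XOR v < d"
  using assms
proof (induction v arbitrary: a b c d rule: less_induct)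
  case (less v)
  show ?case
  proof (cases "v div 2 = 0")
    case True
    then have "v = 1"
      using less.prems by linarith
    moreover have "odd a \<or> odd b \<or> odd c \<or> odd d"
      using less.prems calculation by (metis even_xor_iff odd_one)
    ultimately show ?thesis
      using odd_xor_one_less by metis
  next
    case False
    have "v div 2 < v"
      using False by simp
    moreover have "a div 2 XOR b div 2 XOR c div 2 XOR d div 2 = v div 2"
      using less.prems by (metis xor_div_two)
    ultimately have "(a XOR v) div 2 < a div 2 \<or> (b XOR v) div 2 < b div 2 \<or>
      (c XOR v) div 2 < c div 2 \<or> (d XOR v) div 2 < d div 2"
      unfolding xor_div_two using False by (rule less.IH)
    then show ?thesis
      using xor_less_if_div_two_less by blast
  qed
qed

section \<open>Cuts of the bar as moves in Nim with four heaps\<close>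

lemma breaks_into_fst:
  assumes "p \<in> {(x, y) \<in> B. x \<le> c}" "q \<in> {(x, y) \<in> B. c < x}"
  shows "breaks_into B {(x, y) \<in> B. x \<le> c} {(x, y) \<in> B. c < x}"
  unfolding breaks_into_def by (intro conjI disjI1 exI[of _ c] refl) (use assms in blast)+

lemma breaks_into_snd:
  assumes "p \<in> {(x, y) \<in> B. y \<le> c}" "q \<in> {(x, y) \<in> B. c < y}"
  shows "breaks_into B {(x, y) \<in> B. y \<le> c} {(x, y) \<in> B. c < y}"
  unfolding breaks_into_def by (intro conjI disjI2 exI[of _ c] refl) (use assms in blast)+

lemma moveI:
  shows "p \<in> {(x, y) \<in> B. x \<le> c} \<Longrightarrow> q \<in> {(x, y) \<in> B. c < x} \<Longrightarrow> move p B {(x, y) \<in> B. x \<le> c}"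
    and "p \<in> {(x, y) \<in> B. c < x} \<Longrightarrow> q \<in> {(x, y) \<in> B. x \<le> c} \<Longrightarrow> move p B {(x, y) \<in> B. c < x}"
    and "p \<in> {(x, y) \<in> B. y \<le> c} \<Longrightarrow> q \<in> {(x, y) \<in> B. c < y} \<Longrightarrow> move p B {(x, y) \<in> B. y \<le> c}"
    and "p \<in> {(x, y) \<in> B. c < y} \<Longrightarrow> q \<in> {(x, y) \<in> B. y \<le> c} \<Longrightarrow> move p B {(x, y) \<in> B. c < y}"
  unfolding move_def using breaks_into_fst breaks_into_snd by meson+

text \<open>The cell \<open>q\<close> lies in the eaten piece; it records that this piece is
  nonempty, which later makes the decrease of a heap strict.\<close>

lemma moveE:
  assumes "move p B K"
  obtains (fst_le) c q where "K = {(x, y) \<in> B. x \<le> c}" "p \<in> K" "q \<in> {(x, y) \<in> B. c < x}"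
  | (fst_gt) c q where "K = {(x, y) \<in> B. c < x}" "p \<in> K" "q \<in> {(x, y) \<in> B. x \<le> c}"
  | (snd_le) c q where "K = {(x, y) \<in> B. y \<le> c}" "p \<in> K" "q \<in> {(x, y) \<in> B. c < y}"
  | (snd_gt) c q where "K = {(x, y) \<in> B. c < y}" "p \<in> K" "q \<in> {(x, y) \<in> B. y \<le> c}"
proof -
  from assms obtain E where p: "p \<in> K" and "breaks_into B K E \<or> breaks_into B E K"
    unfolding move_def by blast
  from this(2) show thesis
  proof
    assume K: "breaks_into B K E"
    then obtain q where q: "q \<in> E"
      unfolding breaks_into_def by blast
    from K consider c where "K = {(x, y) \<in> B. x \<le> c}" "E = {(x, y) \<in> B. c < x}"
      | c where "K = {(x, y) \<in> B. y \<le> c}" "E = {(x, y) \<in> B. c < y}"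
      unfolding breaks_into_def by (elim conjE disjE exE)
    then show thesis
      by cases (use p q that(1,3) in blast)+
  next
    assume K: "breaks_into B E K"
    then obtain q where q: "q \<in> E"
      unfolding breaks_into_def by blast
    from K consider c where "K = {(x, y) \<in> B. c < x}" "E = {(x, y) \<in> B. x \<le> c}"
      | c where "K = {(x, y) \<in> B. c < y}" "E = {(x, y) \<in> B. y \<le> c}"
      unfolding breaks_into_def by (elim conjE disjE exE)
    then show thesis
      by cases (use p q that(2,4) in blast)+
  qed
qed

text \<open>The parameters are the four Nim heaps: the numbers of columns and rows on either side of
  the poisoned cell. Anchoring at \<open>p\<close> ensures that a cut changes just one of
  them.\<close>

definition rect :: "cell \<Rightarrow> nat \<Rightarrow> nat \<Rightarrow> nat \<Rightarrow> nat \<Rightarrow> bar" where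
  "rect p a b c d = {fst p - int a..fst p + int b} \<times> {snd p - int c..snd p + int d}"

definition balanced :: "cell \<Rightarrow> bar \<Rightarrow> bool" where
  "balanced p B \<longleftrightarrow> (\<exists>a b c d. B = rect p a b c d \<and> a XOR b XOR c XOR d = 0)"

text \<open>Not the negation of \<open>balanced\<close>: a set that is no rectangle around
  \<open>p\<close> is neither.\<close>

definition unbalanced :: "cell \<Rightarrow> bar \<Rightarrow> bool" where
  "unbalanced p B \<longleftrightarrow> (\<exists>a b c d. B = rect p a b c d \<and> a XOR b XOR c XOR d \<noteq> 0)"

lemma rect_eq_iff: "rect p a b c d = rect p a' b' c' d' \<longleftrightarrow> a = a' \<and> b = b' \<and> c = c' \<and> d = d'"
  unfolding rect_def by (auto simp: times_eq_iff)

lemma finite_rect: "finite (rect p a b c d)"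
  unfolding rect_def by simp

lemma move_rectI:
  shows "a' < a \<Longrightarrow> move p (rect p a b c d) (rect p a' b c d)"
    and "b' < b \<Longrightarrow> move p (rect p a b c d) (rect p a b' c d)"
    and "c' < c \<Longrightarrow> move p (rect p a b c d) (rect p a b c' d)"
    and "d' < d \<Longrightarrow> move p (rect p a b c d) (rect p a b c d')"
proof -
  obtain x y where p: "p = (x, y)"
    by (cases p)
  let ?R = "rect p a b c d"
  show "move p ?R (rect p a' b c d)" if "a' < a"
  proof -
    \<comment> \<open>The kept piece starts at \<open>x - int a'\<close> and the inequality is
      strict, so the cut is one lower. The old border cell \<open>(x - int a, y)\<close> is
      eaten.\<close>
    have eq: "rect p a' b c d = {(u, v) \<in> ?R. x - int a' - 1 < u}"
      using that by (auto simp: rect_def p)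
    show ?thesis
      unfolding eq by (rule moveI(2)[where q = "(x - int a, y)"]) (use that in \<open>auto simp: rect_def p\<close>)
  qed
  show "move p ?R (rect p a b' c d)" if "b' < b"
  proof -
    have eq: "rect p a b' c d = {(u, v) \<in> ?R. u \<le> x + int b'}"
      using that by (auto simp: rect_def p)
    show ?thesis
      unfolding eq by (rule moveI(1)[where q = "(x + int b, y)"]) (use that in \<open>auto simp: rect_def p\<close>)
  qed
  show "move p ?R (rect p a b c' d)" if "c' < c"
  proof -
    have eq: "rect p a b c' d = {(u, v) \<in> ?R. y - int c' - 1 < v}"
      using that by (auto simp: rect_def p)
    show ?thesis
      unfolding eq by (rule moveI(4)[where q = "(x, y - int c)"]) (use that in \<open>auto simp: rect_def p\<close>)
  qed
  show "move p ?R (rect p a b c d')" if "d' < d"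
  proof -
    have eq: "rect p a b c d' = {(u, v) \<in> ?R. v \<le> y + int d'}"
      using that by (auto simp: rect_def p)
    show ?thesis
      unfolding eq by (rule moveI(3)[where q = "(x, y + int d)"]) (use that in \<open>auto simp: rect_def p\<close>)
  qed
qed

lemma move_rectE:
  assumes "move p (rect p a b c d) K"
  obtains a' where "a' < a" "K = rect p a' b c d"
  | b' where "b' < b" "K = rect p a b' c d"
  | c' where "c' < c" "K = rect p a b c' d"
  | d' where "d' < d" "K = rect p a b c d'"
proof -
  obtain x y where p: "p = (x, y)"
    by (cases p)
  from assms show thesis
  proof (cases rule: moveE)
    case (fst_le e q)
    \<comment> \<open>As \<open>p\<close> is kept, \<open>e\<close> is at least \<open>x\<close>, so
      \<open>nat\<close> truncates nothing; as \<open>q\<close> lies beyond the cut,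
      \<open>e\<close> is below \<open>x + int b\<close>.\<close>
    then have "nat (e - x) < b" "K = rect p a (nat (e - x)) c d"
      by (auto simp: rect_def p)
    then show ?thesis by (rule that)
  next
    case (fst_gt e q)
    then have "nat (x - e - 1) < a" "K = rect p (nat (x - e - 1)) b c d"
      by (auto simp: rect_def p)
    then show ?thesis by (rule that)
  next
    case (snd_le e q)
    then have "nat (e - y) < d" "K = rect p a b c (nat (e - y))"
      by (auto simp: rect_def p)
    then show ?thesis by (rule that)
  next
    case (snd_gt e q)
    then have "nat (y - e - 1) < c" "K = rect p a b (nat (y - e - 1)) d"
      by (auto simp: rect_def p)
    then show ?thesis by (rule that)
  qed
qed

text \<open>Supplies the measure for the descent along plays.\<close>

lemma move_card_less:
  assumes "move p B K" "finite B"
  shows "card K < card B"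
proof -
  from assms(1) obtain q where "q \<in> B" "q \<notin> K" "K \<subseteq> B"
    by (cases rule: moveE) (auto intro: that)
  then have "K \<subset> B"
    by blast
  then show ?thesis
    using assms(2) by (rule psubset_card_mono[rotated])
qed

lemma balanced_not_unbalanced: "balanced p B \<Longrightarrow> \<not> unbalanced p B"
  unfolding balanced_def unbalanced_def by (auto simp: rect_eq_iff)

text \<open>The losing bar is Nim with four empty heaps.\<close>

lemma balanced_singleton: "balanced p {p}"
proof -
  have "{p} = rect p 0 0 0 0"
    by (cases p) (simp add: rect_def)
  then show ?thesis
    unfolding balanced_def by force
qed

lemma unbalanced_finite: "unbalanced p B \<Longrightarrow> finite B"
  unfolding unbalanced_def using finite_rect by blast

text \<open>If the Nim sum is zero, each heap is the XOR of the other three, so changing one heap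
  alone destroys the balance.\<close>

lemma balanced_move:
  assumes "balanced p B" "move p B K"
  shows "unbalanced p K"
proof -
  obtain a b c d where B: "B = rect p a b c d" and eq: "a XOR b XOR c XOR d = 0"
    using assms(1) unfolding balanced_def by blast
  note inj = xor_eq_0_iff[THEN iffD1]
  show ?thesis
    using assms(2) unfolding B
  proof (cases rule: move_rectE)
    case (1 a')
    have "a' XOR b XOR c XOR d \<noteq> 0"
      using eq inj[of a' "b XOR c XOR d"] inj[of a "b XOR c XOR d"] 1 by auto
    then show ?thesis unfolding unbalanced_def using 1 by blast
  next
    case (2 b')
    have "a XOR b' XOR c XOR d \<noteq> 0"
      using eq inj[of b' "a XOR c XOR d"] inj[of b "a XOR c XOR d"] 2 by (auto simp: ac_simps)
    then show ?thesis unfolding unbalanced_def using 2 by blast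
  next
    case (3 c')
    have "a XOR b XOR c' XOR d \<noteq> 0"
      using eq inj[of c' "a XOR b XOR d"] inj[of c "a XOR b XOR d"] 3 by (auto simp: ac_simps)
    then show ?thesis unfolding unbalanced_def using 3 by blast
  next
    case (4 d')
    have "a XOR b XOR c XOR d' \<noteq> 0"
      using eq inj[of d' "a XOR b XOR c"] inj[of d "a XOR b XOR c"] 4 by (auto simp: ac_simps)
    then show ?thesis unfolding unbalanced_def using 4 by blast
  qed
qed

text \<open>XORing any heap with the Nim sum \<open>v\<close> makes the total zero; by
  \<open>ex_xor_less\<close> this is a legal decrease for at least one heap.\<close>

lemma unbalanced_move:
  assumes "unbalanced p B"
  obtains K where "move p B K" "balanced p K"
proof -
  obtain a b c d where B: "B = rect p a b c d" and neq: "a XOR b XOR c XOR d \<noteq> 0"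
    using assms unfolding unbalanced_def by blast
  define v where "v = a XOR b XOR c XOR d"
  have v: "(a XOR b XOR c XOR d) XOR v = 0"
    unfolding v_def by simp
  from ex_xor_less[OF v_def[symmetric]] neq
  consider "a XOR v < a" | "b XOR v < b" | "c XOR v < c" | "d XOR v < d"
    unfolding v_def by blast
  then show thesis
  proof cases
    case 1
    show ?thesis
      by (rule that[OF move_rectI(1)[OF 1, of p b c d, folded B]])
        (use v in \<open>auto simp: balanced_def rect_eq_iff ac_simps\<close>)
  next
    case 2
    show ?thesis
      by (rule that[OF move_rectI(2)[OF 2, of p a c d, folded B]])
        (use v in \<open>auto simp: balanced_def rect_eq_iff ac_simps\<close>)
  next
    case 3
    show ?thesis
      by (rule that[OF move_rectI(3)[OF 3, of p a b d, folded B]])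
        (use v in \<open>auto simp: balanced_def rect_eq_iff ac_simps\<close>)
  next
    case 4
    show ?thesis
      by (rule that[OF move_rectI(4)[OF 4, of p a b c, folded B]])
        (use v in \<open>auto simp: balanced_def rect_eq_iff ac_simps\<close>)
  qed
qed

section \<open>Plays and winning strategies\<close>

lemma play_snoc:
  assumes "play m p bs" "move p (last bs) K"
  shows "play m p (bs @ [K])"
  unfolding play_def
proof (intro conjI allI impI)
  show "bs @ [K] \<noteq> []" "hd (bs @ [K]) = full_bar m"
    using assms(1) by (auto simp: play_def)
  fix l assume l: "Suc l < length (bs @ [K])"
  show "move p ((bs @ [K]) ! l) ((bs @ [K]) ! Suc l)"
  proof (cases "Suc l < length bs")
    case True
    then show ?thesis
      using assms(1) by (simp add: play_def nth_append)
  next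
    case False
    then have "l = length bs - 1" "bs \<noteq> []"
      using l assms(1) by (auto simp: play_def)
    then show ?thesis
      using assms(2) by (simp add: nth_append last_conv_nth)
  qed
qed

lemma second_follows_snoc:
  assumes "second_follows \<sigma> bs" "even (length bs) \<Longrightarrow> K = \<sigma> bs"
  shows "second_follows \<sigma> (bs @ [K])"
  unfolding second_follows_def
proof (intro allI impI)
  fix l assume l: "odd l \<and> Suc l < length (bs @ [K])"
  show "(bs @ [K]) ! Suc l = \<sigma> (take (Suc l) (bs @ [K]))"
  proof (cases "Suc l < length bs")
    case True
    then show ?thesis
      using assms(1) l by (simp add: second_follows_def nth_append)
  next
    case False
    then have "Suc l = length bs"
      using l by simp
    then show ?thesis
      using assms(2) l by (metis append_eq_conv_conj even_Suc nth_append_length)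
  qed
qed

lemma balanced_second_wins:
  assumes "balanced p (full_bar m)"
  shows "\<exists>\<sigma>. second_winning_strategy m p \<sigma>"
proof -
  \<comment> \<open>The strategy looks only at the current bar and restores balance. Its value is
    arbitrary where no such move exists, but the invariant below keeps the second player on
    unbalanced bars.\<close>
  define \<sigma> where "\<sigma> bs = (SOME K. move p (last bs) K \<and> balanced p K)" for bs
  have \<sigma>: "move p (last bs) (\<sigma> bs) \<and> balanced p (\<sigma> bs)" if "unbalanced p (last bs)" for bs
    unfolding \<sigma>_def by (rule someI_ex) (use unbalanced_move[OF that] in blast)
  have inv: "if even l then balanced p (bs ! l) else unbalanced p (bs ! l)"
    if "play m p bs" "second_follows \<sigma> bs" "l < length bs" for bs l
    using that(3)
  proof (induction l)
    case 0
    then show ?case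
      using that(1) assms by (auto simp: play_def hd_conv_nth)
  next
    case (Suc l)
    then have mv: "move p (bs ! l) (bs ! Suc l)"
      using that(1) by (simp add: play_def)
    show ?case
    proof (cases "even l")
      case True
      then show ?thesis
        using Suc mv balanced_move by auto
    next
      case False
      have "last (take (Suc l) bs) = bs ! l"
        using Suc.prems by (simp add: take_Suc_conv_app_nth)
      then have "unbalanced p (last (take (Suc l) bs))"
        using False Suc by simp
      then show ?thesis
        using \<sigma> False Suc.prems that(2) by (simp add: second_follows_def)
    qed
  qed
  have "second_winning_strategy m p \<sigma>"
    unfolding second_winning_strategy_def
  proof (intro allI impI)
    fix bs assume bs: "play m p bs \<and> second_follows \<sigma> bs"
    then have ne: "bs \<noteq> []"
      by (simp add: play_def)
    have last: "if odd (length bs) then balanced p (last bs) else unbalanced p (last bs)"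
      using inv[of bs "length bs - 1"] bs ne by (auto simp: last_conv_nth)
    show "(even (length bs) \<and> last bs \<noteq> {p} \<longrightarrow> move p (last bs) (\<sigma> bs)) \<and>
      (last bs = {p} \<longrightarrow> odd (length bs))"
      using last \<sigma> balanced_singleton balanced_not_unbalanced by metis
  qed
  then show ?thesis by blast
qed

text \<open>A play consistent with \<open>\<sigma>\<close> is prolonged by a balancing move of the
  first player and the answer of \<open>\<sigma>\<close>, which is unbalanced again. This would go
  on forever, although the bar shrinks.\<close>

lemma unbalanced_first_wins:
  assumes "second_winning_strategy m p \<sigma>"
    and "play m p bs" "second_follows \<sigma> bs" "odd (length bs)" "unbalanced p (last bs)"
  shows False
  using assms(2-)
proof (induction "card (last bs)" arbitrary: bs rule: less_induct)
  case less
  obtain K where K: "move p (last bs) K" "balanced p K"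
    using unbalanced_move[OF less.prems(4)] .
  define bs1 where "bs1 = bs @ [K]"
  have bs1: "play m p bs1" "second_follows \<sigma> bs1" "even (length bs1)" "last bs1 = K"
    unfolding bs1_def using less.prems K
    by (auto intro: play_snoc second_follows_snoc)
  \<comment> \<open>A winning strategy never lets the second player receive \<open>{p}\<close>, so
    \<open>K\<close> is not \<open>{p}\<close> and \<open>\<sigma>\<close> must give a legal
    move.\<close>
  then have mv: "move p K (\<sigma> bs1)"
    using assms(1) unfolding second_winning_strategy_def by metis
  define bs2 where "bs2 = bs1 @ [\<sigma> bs1]"
  have bs2: "play m p bs2" "second_follows \<sigma> bs2" "odd (length bs2)" "last bs2 = \<sigma> bs1"
    unfolding bs2_def using bs1 mv by (auto intro: play_snoc second_follows_snoc)
  have "finite K"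
    using K(2) unfolding balanced_def by (auto intro: finite_rect)
  then have "card (last bs2) < card (last bs)"
    using move_card_less[OF mv] move_card_less[OF K(1)] unbalanced_finite[OF less.prems(4)]
    by (simp add: bs2(4))
  moreover have "unbalanced p (last bs2)"
    using balanced_move[OF K(2) mv] bs2(4) by simp
  ultimately show False
    using less.hyps bs2 by blast
qed

section \<open>P-positions and their decomposition\<close>

text \<open>The share of one coordinate in the Nim sum. The bar is square, so the same function
  serves both axes, and the Nim sum vanishes iff its two values agree.\<close>

definition axis_xor :: "nat \<Rightarrow> int \<Rightarrow> nat" where
  "axis_xor m i = nat (i - 1) XOR nat (int m - i)"

lemma P_positions_eq:
  "P_positions m = {(i, j). i \<in> {1..int m} \<and> j \<in> {1..int m} \<and> axis_xor m i = axis_xor m j}"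
proof -
  have wins_iff: "(\<exists>\<sigma>. second_winning_strategy m (i, j) \<sigma>) \<longleftrightarrow> axis_xor m i = axis_xor m j"
    if "i \<in> {1..int m}" "j \<in> {1..int m}" for i j
  proof -
    let ?p = "(i, j)"
    let ?x = "nat (i - 1) XOR nat (int m - i) XOR nat (j - 1) XOR nat (int m - j)"
    have full: "full_bar m = rect ?p (nat (i - 1)) (nat (int m - i)) (nat (j - 1)) (nat (int m - j))"
      using that by (simp add: full_bar_def rect_def)
    have iff: "?x = 0 \<longleftrightarrow> axis_xor m i = axis_xor m j"
      using xor_eq_0_iff[of "axis_xor m i" "axis_xor m j"] by (simp add: axis_xor_def xor.assoc)
    show ?thesis
    proof
      assume "axis_xor m i = axis_xor m j"
      then have "balanced ?p (full_bar m)"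
        unfolding balanced_def full using iff by blast
      then show "\<exists>\<sigma>. second_winning_strategy m ?p \<sigma>"
        by (rule balanced_second_wins)
    next
      assume "\<exists>\<sigma>. second_winning_strategy m ?p \<sigma>"
      then obtain \<sigma> where \<sigma>: "second_winning_strategy m ?p \<sigma>" ..
      \<comment> \<open>The initial play has odd length and contains no move yet, so every strategy
        is followed in it.\<close>
      have "play m ?p [full_bar m]" "second_follows \<sigma> [full_bar m]"
        by (simp_all add: play_def second_follows_def)
      then have "\<not> unbalanced ?p (full_bar m)"
        using unbalanced_first_wins[OF \<sigma>] by fastforce
      then show "axis_xor m i = axis_xor m j"
        unfolding unbalanced_def full using iff by blast
    qed
  qed
  show ?thesis
  proof (rule set_eqI)
    fix p
    show "p \<in> P_positions m \<longleftrightarrow>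
      p \<in> {(i, j). i \<in> {1..int m} \<and> j \<in> {1..int m} \<and> axis_xor m i = axis_xor m j}"
      by (cases p) (use wins_iff in \<open>simp add: P_positions_def full_bar_def cong: conj_cong\<close>)
  qed
qed

text \<open>Enlarging the bar keeps the distance to the lower side and adds \<open>2 ^ n\<close> to
  the other. Both old distances are below \<open>2 ^ n\<close>, so only bit \<open>n\<close> of the
  XOR changes. In \<open>axis_xor_high\<close> the two sides exchange roles.\<close>

lemma axis_xor_low:
  assumes "s < 2 ^ n" "i \<in> {1..int s}"
  shows "axis_xor (s + 2 ^ n) i = 2 ^ n + axis_xor s i"
proof -
  have eq: "nat (int (s + N) - i) = N + nat (int s - i)" for N
    using assms by auto
  have "nat (i - 1) < 2 ^ n" "nat (int s - i) < 2 ^ n"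
    using assms by (auto intro: less_trans[OF _ assms(1)] simp del: nat_less_numeral_power_cancel_iff)
  then show ?thesis
    unfolding axis_xor_def eq by (rule xor_power_add(1))
qed

lemma axis_xor_high:
  assumes "s < 2 ^ n" "i \<in> {1..int s}"
  shows "axis_xor (s + 2 ^ n) (i + int (2 ^ n)) = 2 ^ n + axis_xor s i"
proof -
  have eq: "nat (i + int N - 1) = N + nat (i - 1)"
    "nat (int (s + N) - (i + int N)) = nat (int s - i)" for N
    using assms by auto
  have "nat (i - 1) < 2 ^ n" "nat (int s - i) < 2 ^ n"
    using assms by (auto intro: less_trans[OF _ assms(1)] simp del: nat_less_numeral_power_cancel_iff)
  then show ?thesis
    unfolding axis_xor_def eq by (rule xor_power_add(2))
qed

text \<open>In the centre both distances are complements with respect to \<open>mask n\<close> of the two distances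
  in the small bar, in exchanged order, and complementing both operands preserves the XOR.\<close>

lemma axis_xor_centre:
  assumes "s < 2 ^ n" "i \<in> {1..int (2 ^ n - s)}"
  shows "axis_xor (s + 2 ^ n) (i + int s) = axis_xor (2 ^ n - s) i"
proof -
  define N :: nat where "N = 2 ^ n"
  let ?u = "nat (i - 1)" and ?v = "nat (int (2 ^ n - s) - i)"
  have lt: "?u < 2 ^ n" "?v < 2 ^ n"
    and "nat (i + int s - 1) = 2 ^ n - Suc ?v" "nat (int (s + 2 ^ n) - (i + int s)) = 2 ^ n - Suc ?u"
    using assms unfolding N_def[symmetric] by auto
  then have "axis_xor (s + 2 ^ n) (i + int s) = (mask n XOR ?v) XOR (mask n XOR ?u)"
    unfolding axis_xor_def by (simp only: power_minus_Suc_eq_xor[OF lt(1)] power_minus_Suc_eq_xor[OF lt(2)])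
  also have "\<dots> = (mask n XOR mask n) XOR (?u XOR ?v)"
    by (simp only: ac_simps)
  finally show ?thesis
    by (simp add: axis_xor_def)
qed

text \<open>Used for the central interval, to separate its values from those on the outer intervals,
  which are at least \<open>2 ^ n\<close>.\<close>

lemma axis_xor_less:
  assumes "i \<in> {1..int m}" "m \<le> 2 ^ n"
  shows "axis_xor m i < 2 ^ n"
  unfolding axis_xor_def by (rule xor_less_power; rule less_le_trans[OF _ assms(2)]) (use assms(1) in auto)

definition shift :: "int \<Rightarrow> int \<Rightarrow> cell set \<Rightarrow> cell set" where
  "shift u v A = {(i, j). (i - u, j - v) \<in> A}"

lemma P_positions_decomposition:
  assumes "s < 2 ^ n"
  shows "P_positions (s + 2 ^ n) = P_positions s \<union> shift (2 ^ n) 0 (P_positions s)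
    \<union> shift 0 (2 ^ n) (P_positions s) \<union> shift (2 ^ n) (2 ^ n) (P_positions s)
    \<union> shift (int s) (int s) (P_positions (2 ^ n - s))"
proof -
  define m where "m = s + 2 ^ n"
  define t where "t = (2 ^ n - s :: nat)"
  define T :: int where "T = 2 ^ n"
  let ?low = "\<lambda>i. i \<in> {1..int s}" and ?high = "\<lambda>i. i - T \<in> {1..int s}"
    and ?centre = "\<lambda>i. i - int s \<in> {1..int t}"
  have st: "int t = T - int s" "int s < T" "int m = int s + T"
    using assms by (auto simp: t_def T_def m_def of_nat_diff)
  \<comment> \<open>Since \<open>m = s + t + s\<close> and \<open>s + t = T\<close>, the low,
    central and high intervals follow one another in this order and partition the range.\<close>
  have split: "i \<in> {1..int m} \<longleftrightarrow> ?low i \<or> ?high i \<or> ?centre i" for i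
    using st by auto
  have disj: "\<not> (?low i \<and> ?high i)" "\<not> (?low i \<and> ?centre i)" "\<not> (?high i \<and> ?centre i)" for i
    using st by auto
  have low: "axis_xor m i = 2 ^ n + axis_xor s i" if "?low i" for i
    using axis_xor_low[OF assms that] by (simp add: m_def)
  have high: "axis_xor m i = 2 ^ n + axis_xor s (i - T)" if "?high i" for i
    using axis_xor_high[OF assms that] by (simp add: m_def T_def)
  have centre: "axis_xor m i = axis_xor t (i - int s)" "axis_xor m i < 2 ^ n" if "?centre i" for i
    using axis_xor_centre[OF assms that[unfolded t_def]] axis_xor_less[OF that, of n]
    by (simp_all add: m_def t_def)
  have "(i, j) \<in> P_positions m \<longleftrightarrow>
     (i, j) \<in> P_positions s \<union> shift T 0 (P_positions s) \<union> shift 0 T (P_positions s)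
       \<union> shift T T (P_positions s) \<union> shift (int s) (int s) (P_positions t)" for i j
  proof -
    have "(i, j) \<in> P_positions m \<longleftrightarrow>
      (?low i \<or> ?high i \<or> ?centre i) \<and> (?low j \<or> ?high j \<or> ?centre j) \<and> axis_xor m i = axis_xor m j"
      unfolding P_positions_eq[of m] split[symmetric] by simp
    \<comment> \<open>An outer and a central coordinate never have equal values, since these lie on
      different sides of \<open>2 ^ n\<close>. Between two outer ones the summand
      \<open>2 ^ n\<close> cancels, which leaves four corners and the centre.\<close>
    also have "\<dots> \<longleftrightarrow>
      ?low i \<and> ?low j \<and> axis_xor s i = axis_xor s j \<or>
      ?high i \<and> ?low j \<and> axis_xor s (i - T) = axis_xor s j \<or>
      ?low i \<and> ?high j \<and> axis_xor s i = axis_xor s (j - T) \<or>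
      ?high i \<and> ?high j \<and> axis_xor s (i - T) = axis_xor s (j - T) \<or>
      ?centre i \<and> ?centre j \<and> axis_xor t (i - int s) = axis_xor t (j - int s)"
      using low[of i] low[of j] high[of i] high[of j] centre[of i] centre[of j] disj[of i] disj[of j]
      by (smt (verit, del_insts) add_left_cancel not_add_less1)
    also have "\<dots> \<longleftrightarrow> (i, j) \<in> P_positions s \<union> shift T 0 (P_positions s) \<union> shift 0 T (P_positions s)
       \<union> shift T T (P_positions s) \<union> shift (int s) (int s) (P_positions t)"
      unfolding P_positions_eq shift_def by simp
    finally show ?thesis .
  qed
  then show ?thesis
    unfolding m_def t_def T_def by (intro set_eqI) (metis surj_pair)
qed

section \<open>From cells to unit squares in the plane\<close>

text \<open>\<open>pattern\<close> for an arbitrary set of cells, so that it can be distributed over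
  the unions and shifts of the decomposition.\<close>

definition squares :: "cell set \<Rightarrow> (real \<times> real) set" where
  "squares A = {(real_of_int i - x, real_of_int j - y) | i j x y.
     0 \<le> x \<and> x \<le> 1 \<and> 0 \<le> y \<and> y \<le> 1 \<and> (i, j) \<in> A}"

lemma pattern_eq_squares: "pattern m = squares (P_positions m)"
  unfolding pattern_def squares_def ..

lemma squares_Un: "squares (A \<union> B) = squares A \<union> squares B"
  unfolding squares_def by blast

lemma squares_shift: "squares (shift u v A) = translate (squares A) (of_int u, of_int v)"
proof (intro equalityI subsetI)
  fix q assume "q \<in> squares (shift u v A)"
  then obtain i j x y where q: "q = (real_of_int i - x, real_of_int j - y)"
    "0 \<le> x" "x \<le> 1" "0 \<le> y" "y \<le> 1" "(i - u, j - v) \<in> A"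
    unfolding squares_def shift_def by auto
  then have "(real_of_int (i - u) - x, real_of_int (j - v) - y) \<in> squares A"
    unfolding squares_def by blast
  moreover have "q = (real_of_int (i - u) - x, real_of_int (j - v) - y) + (of_int u, of_int v)"
    using q by simp
  ultimately show "q \<in> translate (squares A) (of_int u, of_int v)"
    unfolding translate_def by blast
next
  fix q assume "q \<in> translate (squares A) (of_int u, of_int v)"
  then obtain i j x y where
    q: "q = (real_of_int i - x, real_of_int j - y) + (of_int u, of_int v)"
    "0 \<le> x" "x \<le> 1" "0 \<le> y" "y \<le> 1" "(i, j) \<in> A"
    unfolding squares_def translate_def by auto
  then have "(i + u, j + v) \<in> shift u v A" "q = (real_of_int (i + u) - x, real_of_int (j + v) - y)"
    unfolding shift_def by simp_all
  then show "q \<in> squares (shift u v A)"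
    unfolding squares_def using q by blast
qed

text \<open>Each new digit adds at most \<open>2 ^ Suc k\<close> to a sum already below
  \<open>2 ^ Suc k\<close>. This provides \<open>s < 2 ^ n\<close> for
  \<open>n = k + 1\<close>.\<close>

lemma binary_expansion_less:
  fixes a :: "nat \<Rightarrow> nat"
  assumes "\<And>l. l \<le> k \<Longrightarrow> a l \<in> {0, 1}"
  shows "(\<Sum>l\<le>k. a l * 2 ^ l) < 2 ^ (k + 1)"
  using assms
proof (induction k)
  case 0
  then show ?case by force
next
  case (Suc k)
  have "a (Suc k) = 0 \<or> a (Suc k) = 1"
    using Suc.prems[of "Suc k"] by auto
  moreover have "(\<Sum>l\<le>k. a l * 2 ^ l) < 2 ^ Suc k"
    using Suc by simp
  ultimately show ?case
    by auto
qed

theorem theorem3: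
  fixes m k s t :: nat and a :: "nat \<Rightarrow> nat"
  assumes "m \<ge> 2"
    and "\<And>l. l \<le> k \<Longrightarrow> a l \<in> {0, 1}"
    and "m = (\<Sum>l\<le>k. a l * 2 ^ l) + 2 ^ (k + 1)"
    and "s = (\<Sum>l\<le>k. a l * 2 ^ l)"
    and "t = 2 ^ (k + 1) - s"
  shows "pattern m =
    pattern s
    \<union> translate (pattern s) (real m - real s, 0)
    \<union> translate (pattern s) (0, real m - real s)
    \<union> translate (pattern s) (real m - real s, real m - real s)
    \<union> translate (pattern t) (real s, real s)"
proof -
  have s: "s < 2 ^ (k + 1)"
    unfolding assms(4) by (rule binary_expansion_less) (rule assms(2))
  have m: "m = s + 2 ^ (k + 1)"
    using assms(3,4) by simp
  \<comment> \<open>The real offset of the corner copies is the integer cell shift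
    \<open>2 ^ (k + 1)\<close>.\<close>
  then have diff: "real m - real s = of_int (2 ^ (k + 1))"
    by simp
  have "pattern m = squares (P_positions s \<union> shift (2 ^ (k + 1)) 0 (P_positions s)
    \<union> shift 0 (2 ^ (k + 1)) (P_positions s) \<union> shift (2 ^ (k + 1)) (2 ^ (k + 1)) (P_positions s)
    \<union> shift (int s) (int s) (P_positions t))"
    unfolding pattern_eq_squares m P_positions_decomposition[OF s] assms(5) ..
  then show ?thesis
    unfolding squares_Un squares_shift diff pattern_eq_squares by simp
qed

end
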